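(* Let $N\ge1$ be an integer and $h=\frac1N$. In the space $L_2^{(3)}(0,1)$, among quadrature formulas of the form $$\int_0^1\varphi(x)\,dx\cong\sum_{\beta=0}^N C[\beta]\,\varphi(h\beta)+A\varphi'(0)+B\varphi'(1)$$ there exists a unique optimal formula, and its coefficients are $$C[\beta]=\begin{cases}\frac h2,&\beta=0,N,\\ h,&\beta=1,\dots,N-1,\end{cases}\qquad A=\frac{h^2}{12},\qquad B=-\frac{h^2}{12}.$$ Furthermore, the error functional $\ell$ of this optimal formula satisfies $$\left\|\ell|L_2^{(3)*}(0,1)\right\|^2=\frac{h^6}{30240}.$$
   Context: $L_2^{(3)}(0,1)$ is the Sobolev space of real functions $\varphi$ on $[0,1]$ with $\varphi'''\in L_2(0,1)$, equipped with the (semi)norm $\|\varphi\|_{L_2^{(3)}(0,1)}=\left(\int_0^1(\varphi'''(x))^2dx\right)^{1/2}$. For real coefficients $C[0],\dots,C[N],A,B$, the error functional of the quadrature formula is $$(\ell,\varphi)=\int_0^1\varphi(x)\,dx-\sum_{\beta=0}^N C[\beta]\varphi(h\beta)-A\varphi'(0)-B\varphi'(1),$$ and its norm is $\|\ell|L_2^{(3)*}(0,1)\|=\sup_{\|\varphi\|_{L_2^{(3)}(0,1)}=1}|(\ell,\varphi)|$. Finiteness of this norm requires $(\ell,x^\alpha)=0$ for $\alpha=0,1,2$. The quadrature formula is called optimal if its coefficients attain the infimum of $\|\ell|L_2^{(3)*}(0,1)\|$ over all choices of $C[\beta]$ ($0\le\beta\le N$), $A$, $B$, with the nodes $h\beta$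 fixed. *)

theory Defs
  imports "HOL-Analysis.Analysis"
begin

text \<open>
  Functions on the unit interval are modelled as functions of type
  \<open>real \<Rightarrow> real\<close> of which only the values on \<open>{0..1}\<close> matter; accordingly, derivatives
  are taken within \<open>{0..1}\<close>, hence are one-sided at the end points.
\<close>

definition D01 :: "(real \<Rightarrow> real) \<Rightarrow> real \<Rightarrow> real" where
  "D01 f x = vector_derivative f (at x within {0..1})"

text \<open>
  Absolute continuity of a function on a set of reals. The library constant
  \<open>absolutely_continuous\<close> is about measures.
  A \<open>division_of\<close> is a finite family of non-overlapping compact intervals.
\<close>

definition abs_continuous_on :: "real set \<Rightarrow> (real \<Rightarrow> real) \<Rightarrow> bool" where
  "abs_continuous_on S f \<longleftrightarrow>
     (\<forall>\<epsilon>>0. \<exists>\<delta>>0. \<forall>\<D> T. \<D> division_of T \<and> T \<subseteq> S \<and> (\<Sum>K\<in>\<D>. measure lborel K) < \<delta> \<longrightarrow>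
        (\<Sum>K\<in>\<D>. \<bar>f (Sup K) - f (Inf K)\<bar>) < \<epsilon>)"

text \<open>
  The Sobolev space of order three on the unit interval, each class of functions being
  represented by its twice continuously differentiable member: the second derivative is absolutely
  continuous, and the third derivative, which therefore exists almost everywhere, is square
  integrable. The almost-everywhere differentiability of the second derivative follows from
  its absolute continuity (Lebesgue) and is spelled out only because \<open>vector_derivative\<close> is
  a total function.
\<close>

definition L23 :: "(real \<Rightarrow> real) set" where
  "L23 = {\<phi>.
     (\<forall>x\<in>{0..1}. \<phi> differentiable (at x within {0..1})) \<and>
     (\<forall>x\<in>{0..1}. D01 \<phi> differentiable (at x within {0..1})) \<and>
     abs_continuous_on {0..1} (D01 (D01 \<phi>)) \<and>
     (AE x in lebesgue_on {0..1}. D01 (D01 \<phi>) differentiable (at x within {0..1})) \<and>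
     D01 (D01 (D01 \<phi>)) \<in> borel_measurable (lebesgue_on {0..1}) \<and>
     integrable (lebesgue_on {0..1}) (\<lambda>x. (D01 (D01 (D01 \<phi>)) x)\<^sup>2)}"

definition L23_seminorm :: "(real \<Rightarrow> real) \<Rightarrow> real" where
  "L23_seminorm \<phi> = sqrt (integral\<^sup>L (lebesgue_on {0..1}) (\<lambda>x. (D01 (D01 (D01 \<phi>)) x)\<^sup>2))"

definition error_functional ::
  "nat \<Rightarrow> (nat \<Rightarrow> real) \<Rightarrow> real \<Rightarrow> real \<Rightarrow> (real \<Rightarrow> real) \<Rightarrow> real" where
  "error_functional N C A B \<phi> =
     integral {0..1} \<phi> - (\<Sum>\<beta>=0..N. C \<beta> * \<phi> (1 / real N * real \<beta>))
       - A * D01 \<phi> 0 - B * D01 \<phi> 1"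

text \<open>
  The dual norm is an extended real: it is infinite unless the formula is exact for
  polynomials of degree at most two.
\<close>

definition error_norm :: "nat \<Rightarrow> (nat \<Rightarrow> real) \<Rightarrow> real \<Rightarrow> real \<Rightarrow> ereal" where
  "error_norm N C A B =
     (SUP \<phi>\<in>{\<phi>\<in>L23. L23_seminorm \<phi> = 1}. ereal \<bar>error_functional N C A B \<phi>\<bar>)"

definition optimal_quadrature :: "nat \<Rightarrow> (nat \<Rightarrow> real) \<Rightarrow> real \<Rightarrow> real \<Rightarrow> bool" where
  "optimal_quadrature N C A B \<longleftrightarrow>
     error_norm N C A B = (INF (C', A', B')\<in>UNIV. error_norm N C' A' B')"

end

theory Submission
  imports Defs
begin

text \<open>
  The formula with the claimed coefficients is the trapezoidal rule with the end correction
  \<open>h\<^sup>2/12 (\<phi>'(0) - \<phi>'(1))\<close>. Write \<open>B\<^sub>3, B\<^sub>6\<close> for the Bernoulli polynomials and \<open>{y}\<close> for the fractional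
  part of \<open>y\<close>. Three integrations by parts on every panel of length \<open>h\<close> show that the error of this
  formula is \<open>\<integral> K \<phi>'''\<close> with the kernel \<open>K(x) = -(h\<^sup>3/6) B\<^sub>3({N x})\<close>
  (\<open>corrected_trapezoid_peano\<close>). As \<open>\<integral> K\<^sup>2 = h\<^sup>6/30240\<close>, the norm of the error functional is at most the
  square root \<open>m\<close> of this number (\<open>corrected_trapezoid_error_norm_le\<close>).

  No formula of the given shape does better, for the following reason. The periodic spline
  \<open>u(x) = B\<^sub>6({N x}) - B\<^sub>6(0)\<close> has a third derivative proportional to \<open>K\<close>, and both \<open>u\<close> and \<open>u'\<close> vanish at
  all nodes. So every formula assigns to \<open>u\<close> the value \<open>0\<close>, and every error functional takes the same
  value \<open>\<integral> u = -1/42\<close> at \<open>u\<close> (\<open>error_functional_extremal\<close>). The quotient of \<open>1/42\<close> by the seminorm of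
  \<open>u\<close> is exactly \<open>m\<close> (\<open>error_norm_ge\<close>).

  Uniqueness comes from a variation around \<open>u\<close>. If the norm of an error functional \<open>l\<close> is at most
  \<open>m\<close>, then \<open>t \<mapsto> m\<^sup>2 \<integral> (u''' + t g''')\<^sup>2 - l(u + t g)\<^sup>2\<close> is nonnegative near \<open>0\<close> and vanishes
  at \<open>0\<close>. Its derivative at \<open>0\<close> is therefore zero, which expresses \<open>l(g)\<close> by \<open>\<integral> u''' g'''\<close>
  alone (\<open>error_functional_determined\<close>). So two optimal formulas agree on all polynomials, and
  polynomials with prescribed zeros at the nodes isolate each coefficient
  (\<open>poly_functional_coeffs_zero\<close>).

  The analytic difficulty is the integration by parts: the second derivative of a
  member of the Sobolev space is only absolutely continuous. The fundamental theorem of calculus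
  for absolutely continuous functions that are differentiable almost everywhere
  (\<open>fundamental_theorem_of_calculus_abs_continuous\<close>) is proved by a gauge argument.
\<close>

section \<open>Absolutely continuous functions\<close>

lemma division_endpoints:
  fixes S :: "real set"
  assumes "\<D> division_of T" "T \<subseteq> S" "K \<in> \<D>"
  shows "Inf K \<in> S" "Sup K \<in> S" "Inf K \<le> Sup K" "measure lborel K = Sup K - Inf K"
proof -
  obtain u v where K: "K = cbox u v" "K \<noteq> {}" "K \<subseteq> S"
    using division_ofD[OF assms(1)] assms(2,3) by (metis subset_trans)
  then have "u \<le> v" by auto
  with K show "Inf K \<in> S" "Sup K \<in> S" "Inf K \<le> Sup K" "measure lborel K = Sup K - Inf K"
    by auto
qed

lemma abs_continuous_on_subset:
  assumes "abs_continuous_on S f" "T \<subseteq> S"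
  shows "abs_continuous_on T f"
  unfolding abs_continuous_on_def
proof (intro allI impI)
  fix \<epsilon> :: real assume "\<epsilon> > 0"
  with assms(1) obtain \<delta> where "\<delta> > 0" and \<delta>: "\<And>\<D> U. \<D> division_of U \<Longrightarrow> U \<subseteq> S \<Longrightarrow>
      (\<Sum>K\<in>\<D>. measure lborel K) < \<delta> \<Longrightarrow> (\<Sum>K\<in>\<D>. \<bar>f (Sup K) - f (Inf K)\<bar>) < \<epsilon>"
    unfolding abs_continuous_on_def by meson
  then show "\<exists>\<delta>>0. \<forall>\<D> U. \<D> division_of U \<and> U \<subseteq> T \<and> (\<Sum>K\<in>\<D>. measure lborel K) < \<delta> \<longrightarrow>
      (\<Sum>K\<in>\<D>. \<bar>f (Sup K) - f (Inf K)\<bar>) < \<epsilon>"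
    using assms(2) by (intro exI[of _ \<delta>]) auto
qed

lemma lipschitz_imp_abs_continuous_on:
  fixes f :: "real \<Rightarrow> real"
  assumes L: "\<And>x y. x \<in> S \<Longrightarrow> y \<in> S \<Longrightarrow> \<bar>f x - f y\<bar> \<le> L * \<bar>x - y\<bar>"
  shows "abs_continuous_on S f"
  unfolding abs_continuous_on_def
proof (intro allI impI)
  fix \<epsilon> :: real assume "\<epsilon> > 0"
  define \<delta> where "\<delta> = \<epsilon> / (\<bar>L\<bar> + 1)"
  have "\<delta> > 0" using \<open>\<epsilon> > 0\<close> by (simp add: \<delta>_def add_nonneg_pos)
  moreover have "(\<Sum>K\<in>\<D>. \<bar>f (Sup K) - f (Inf K)\<bar>) < \<epsilon>"
    if "\<D> division_of T" "T \<subseteq> S" and small: "(\<Sum>K\<in>\<D>. measure lborel K) < \<delta>" for \<D> T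
  proof -
    note ends = division_endpoints[OF that(1,2)]
    have "(\<Sum>K\<in>\<D>. \<bar>f (Sup K) - f (Inf K)\<bar>) \<le> (\<Sum>K\<in>\<D>. (\<bar>L\<bar> + 1) * measure lborel K)"
    proof (rule sum_mono)
      fix K assume K: "K \<in> \<D>"
      have "\<bar>f (Sup K) - f (Inf K)\<bar> \<le> L * \<bar>Sup K - Inf K\<bar>"
        using ends[OF K] L by blast
      also have "\<dots> \<le> (\<bar>L\<bar> + 1) * \<bar>Sup K - Inf K\<bar>" by (intro mult_right_mono) auto
      finally show "\<bar>f (Sup K) - f (Inf K)\<bar> \<le> (\<bar>L\<bar> + 1) * measure lborel K"
        using ends[OF K] by simp
    qed
    also have "\<dots> = (\<bar>L\<bar> + 1) * (\<Sum>K\<in>\<D>. measure lborel K)" by (simp add: sum_distrib_left)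
    also have "\<dots> < (\<bar>L\<bar> + 1) * \<delta>" using small by (intro mult_strict_left_mono) auto
    also have "\<dots> = \<epsilon>" by (simp add: \<delta>_def add_nonneg_pos less_imp_neq[symmetric] abs_ge_zero)
    finally show ?thesis .
  qed
  ultimately show "\<exists>\<delta>>0. \<forall>\<D> T. \<D> division_of T \<and> T \<subseteq> S \<and> (\<Sum>K\<in>\<D>. measure lborel K) < \<delta> \<longrightarrow>
      (\<Sum>K\<in>\<D>. \<bar>f (Sup K) - f (Inf K)\<bar>) < \<epsilon>" by blast
qed

lemma C1_imp_abs_continuous_on:
  assumes der: "\<And>x. x \<in> {a..b} \<Longrightarrow> (f has_vector_derivative f' x) (at x within {a..b})"
    and cont: "continuous_on {a..b} f'"
  shows "abs_continuous_on {a..b} (f :: real \<Rightarrow> real)"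
proof -
  have "bounded (f' ` {a..b})"
    using cont by (simp add: compact_continuous_image compact_imp_bounded)
  then obtain L where L: "\<And>x. x \<in> {a..b} \<Longrightarrow> \<bar>f' x\<bar> \<le> L"
    unfolding bounded_iff real_norm_def by (meson imageI)
  have "\<bar>f x - f y\<bar> \<le> L * \<bar>x - y\<bar>" if "x \<in> {a..b}" "y \<in> {a..b}" for x y
  proof -
    have "norm (f x - f y) \<le> L * norm (x - y)"
    proof (rule differentiable_bound[OF convex_real_interval(5)])
      fix z assume z: "z \<in> {a..b}"
      show "(f has_derivative (\<lambda>t. t *\<^sub>R f' z)) (at z within {a..b})"
        using der[OF z] by (simp add: has_vector_derivative_def)
      show "onorm (\<lambda>t. t *\<^sub>R f' z) \<le> L"
        by (rule onorm_le) (use L[OF z] in \<open>simp add: abs_mult mult.commute[of L] mult_left_mono\<close>)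
    qed (use that in auto)
    then show ?thesis by simp
  qed
  then show ?thesis by (rule lipschitz_imp_abs_continuous_on)
qed

lemma abs_continuous_on_imp_continuous_on:
  assumes "abs_continuous_on {a..b} f"
  shows "continuous_on {a..b} (f :: real \<Rightarrow> real)"
  unfolding continuous_on_iff
proof (intro ballI allI impI)
  fix x \<epsilon> :: real assume x: "x \<in> {a..b}" and "\<epsilon> > 0"
  then obtain \<delta> where "\<delta> > 0" and \<delta>: "\<And>\<D> T. \<D> division_of T \<Longrightarrow> T \<subseteq> {a..b} \<Longrightarrow>
      (\<Sum>K\<in>\<D>. measure lborel K) < \<delta> \<Longrightarrow> (\<Sum>K\<in>\<D>. \<bar>f (Sup K) - f (Inf K)\<bar>) < \<epsilon>"
    using assms unfolding abs_continuous_on_def by meson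
  have "dist (f y) (f x) < \<epsilon>" if y: "y \<in> {a..b}" "dist y x < \<delta>" for y
  proof -
    let ?K = "{min x y..max x y}"
    have "{?K} division_of ?K" using division_of_self[of "min x y" "max x y"] by simp
    from \<delta>[OF this] have "\<bar>f (max x y) - f (min x y)\<bar> < \<epsilon>"
      using x y by (auto simp: dist_real_def min_def max_def split: if_splits)
    then show ?thesis by (auto simp: dist_real_def min_def max_def split: if_splits)
  qed
  then show "\<exists>d>0. \<forall>x'\<in>{a..b}. dist x' x < d \<longrightarrow> dist (f x') (f x) < \<epsilon>"
    using \<open>\<delta> > 0\<close> by blast
qed

lemma abs_continuous_on_mult:
  assumes f: "abs_continuous_on {a..b} f" and g: "abs_continuous_on {a..b} g"
  shows "abs_continuous_on {a..b} (\<lambda>x. f x * g x)"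
  unfolding abs_continuous_on_def
proof (intro allI impI)
  fix \<epsilon> :: real assume "\<epsilon> > 0"
  have "bounded (f ` {a..b})" "bounded (g ` {a..b})"
    using f g by (auto intro!: compact_imp_bounded compact_continuous_image
        abs_continuous_on_imp_continuous_on)
  then obtain M1 M2 where M12: "M1 > 0" "\<And>x. x \<in> {a..b} \<Longrightarrow> \<bar>f x\<bar> \<le> M1"
      "\<And>x. x \<in> {a..b} \<Longrightarrow> \<bar>g x\<bar> \<le> M2"
    unfolding bounded_pos real_norm_def by (meson imageI)
  define M where "M = max M1 M2"
  have "M > 0" using M12(1) by (simp add: M_def)
  have Mf: "\<bar>f x\<bar> \<le> M" and Mg: "\<bar>g x\<bar> \<le> M" if "x \<in> {a..b}" for x
    using M12(2,3)[OF that] by (auto simp: M_def)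
  define e where "e = \<epsilon> / (2 * M)"
  have "e > 0" using \<open>\<epsilon> > 0\<close> \<open>M > 0\<close> by (simp add: e_def)
  obtain d1 where "d1 > 0" and d1: "\<And>\<D> T. \<D> division_of T \<Longrightarrow> T \<subseteq> {a..b} \<Longrightarrow>
      (\<Sum>K\<in>\<D>. measure lborel K) < d1 \<Longrightarrow> (\<Sum>K\<in>\<D>. \<bar>f (Sup K) - f (Inf K)\<bar>) < e"
    using f \<open>e > 0\<close> unfolding abs_continuous_on_def by meson
  obtain d2 where "d2 > 0" and d2: "\<And>\<D> T. \<D> division_of T \<Longrightarrow> T \<subseteq> {a..b} \<Longrightarrow>
      (\<Sum>K\<in>\<D>. measure lborel K) < d2 \<Longrightarrow> (\<Sum>K\<in>\<D>. \<bar>g (Sup K) - g (Inf K)\<bar>) < e"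
    using g \<open>e > 0\<close> unfolding abs_continuous_on_def by meson
  have "(\<Sum>K\<in>\<D>. \<bar>f (Sup K) * g (Sup K) - f (Inf K) * g (Inf K)\<bar>) < \<epsilon>"
    if D: "\<D> division_of T" "T \<subseteq> {a..b}" and small: "(\<Sum>K\<in>\<D>. measure lborel K) < min d1 d2" for \<D> T
  proof -
    have "(\<Sum>K\<in>\<D>. \<bar>f (Sup K) * g (Sup K) - f (Inf K) * g (Inf K)\<bar>)
        \<le> (\<Sum>K\<in>\<D>. M * \<bar>g (Sup K) - g (Inf K)\<bar> + M * \<bar>f (Sup K) - f (Inf K)\<bar>)"
    proof (rule sum_mono)
      fix K assume K: "K \<in> \<D>"
      note ends = division_endpoints[OF D K]
      have "f (Sup K) * g (Sup K) - f (Inf K) * g (Inf K) =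
          f (Sup K) * (g (Sup K) - g (Inf K)) + g (Inf K) * (f (Sup K) - f (Inf K))"
        by (simp add: algebra_simps)
      also have "\<bar>\<dots>\<bar> \<le> \<bar>f (Sup K)\<bar> * \<bar>g (Sup K) - g (Inf K)\<bar> + \<bar>g (Inf K)\<bar> * \<bar>f (Sup K) - f (Inf K)\<bar>"
        by (metis abs_mult abs_triangle_ineq)
      also have "\<dots> \<le> M * \<bar>g (Sup K) - g (Inf K)\<bar> + M * \<bar>f (Sup K) - f (Inf K)\<bar>"
        using ends Mf Mg by (intro add_mono mult_right_mono) auto
      finally show "\<bar>f (Sup K) * g (Sup K) - f (Inf K) * g (Inf K)\<bar>
          \<le> M * \<bar>g (Sup K) - g (Inf K)\<bar> + M * \<bar>f (Sup K) - f (Inf K)\<bar>" .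
    qed
    also have "\<dots> = M * (\<Sum>K\<in>\<D>. \<bar>g (Sup K) - g (Inf K)\<bar>) + M * (\<Sum>K\<in>\<D>. \<bar>f (Sup K) - f (Inf K)\<bar>)"
      by (simp add: sum.distrib sum_distrib_left)
    also have "\<dots> < M * e + M * e"
      using d1[OF D] d2[OF D] small \<open>M > 0\<close> by (intro add_strict_mono mult_strict_left_mono) auto
    also have "\<dots> = \<epsilon>" using \<open>M > 0\<close> by (simp add: e_def)
    finally show ?thesis .
  qed
  then show "\<exists>\<delta>>0. \<forall>\<D> T. \<D> division_of T \<and> T \<subseteq> {a..b} \<and> (\<Sum>K\<in>\<D>. measure lborel K) < \<delta> \<longrightarrow>
      (\<Sum>K\<in>\<D>. \<bar>f (Sup K) * g (Sup K) - f (Inf K) * g (Inf K)\<bar>) < \<epsilon>"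
    using \<open>d1 > 0\<close> \<open>d2 > 0\<close> by (intro exI[of _ "min d1 d2"]) auto
qed

text \<open>
  The error of the linear approximation at a tag bounds the error over an interval that contains
  the tag, because the two halves of the interval add up.
\<close>

lemma straddle:
  fixes f :: "real \<Rightarrow> real"
  assumes "x \<in> {u..v}"
    and "\<And>y. y \<in> {u..v} \<Longrightarrow> \<bar>f y - f x - (y - x) * D\<bar> \<le> e * \<bar>y - x\<bar>"
  shows "\<bar>(v - u) * D - (f v - f u)\<bar> \<le> e * (v - u)"
proof -
  have "(v - u) * D - (f v - f u) = (f u - f x - (u - x) * D) - (f v - f x - (v - x) * D)"
    by (simp add: algebra_simps)
  also have "\<bar>\<dots>\<bar> \<le> e * \<bar>u - x\<bar> + e * \<bar>v - x\<bar>"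
    using assms(2)[of u] assms(2)[of v] assms(1) by simp
  also have "\<dots> = e * (v - u)" using assms(1) by (simp add: algebra_simps)
  finally show ?thesis .
qed

text \<open>
  The gauge separates two kinds of tags. At a tag outside \<open>E\<close> it enforces the straddle estimate,
  so that these intervals contribute at most a small multiple of their length. At a tag in \<open>E\<close> it
  forces the interval into an open set \<open>U\<close> that contains \<open>E\<close> and has small measure; absolute continuity then
  bounds the total increment of \<open>f\<close> over those intervals, while the integrand is replaced by zero on
  \<open>E\<close>.
\<close>

theorem fundamental_theorem_of_calculus_abs_continuous:
  fixes f :: "real \<Rightarrow> real"
  assumes "a \<le> b" and ac: "abs_continuous_on {a..b} f" and neg: "negligible E"
    and der: "\<And>x. x \<in> {a..b} - E \<Longrightarrow> (f has_vector_derivative f' x) (at x within {a..b})"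
  shows "(f' has_integral (f b - f a)) {a..b}"
proof (cases "a = b")
  case True then show ?thesis by (auto intro: has_integral_null_real)
next
  case False
  with \<open>a \<le> b\<close> have "a < b" by simp
  define g where "g x = (if x \<in> E then 0 else f' x)" for x
  have "(g has_integral (f b - f a)) {a..b}"
    unfolding has_integral_factor_content_real
  proof (intro allI impI)
    fix e :: real assume "e > 0"
    define e1 where "e1 = e / 2"
    define e2 where "e2 = e / 2 * (b - a)"
    have e12: "e1 > 0" "e2 > 0" "e1 * (b - a) + e2 = e * measure lborel {a..b}"
      using \<open>e > 0\<close> \<open>a < b\<close> by (auto simp: e1_def e2_def field_simps)
    obtain \<delta> where "\<delta> > 0" and \<delta>: "\<And>\<D> T. \<D> division_of T \<Longrightarrow> T \<subseteq> {a..b} \<Longrightarrow>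
        (\<Sum>K\<in>\<D>. measure lborel K) < \<delta> \<Longrightarrow> (\<Sum>K\<in>\<D>. \<bar>f (Sup K) - f (Inf K)\<bar>) < e2"
      using ac e12(2) unfolding abs_continuous_on_def by meson
    obtain U where U: "open U" "E \<subseteq> U" "U - E \<in> lmeasurable" "emeasure lebesgue (U - E) < ennreal \<delta>"
      using sets_lebesgue_outer_open[of E \<delta>] neg negligible_imp_sets[of E] \<open>\<delta> > 0\<close> by metis
    have "U = (U - E) \<union> E" using U(2) by blast
    then have Ulm: "U \<in> lmeasurable"
      by (metis U(3) fmeasurable.Un neg negligible_imp_measurable)
    have "measure lebesgue U = measure lebesgue (U - E)"
      using Ulm neg by (simp add: fmeasurableD measure_Diff_null_set negligible_iff_null_sets)
    also have "\<dots> < \<delta>"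
      using U(3,4) \<open>\<delta> > 0\<close> by (simp add: emeasure_eq_measure2 ennreal_less_iff)
    finally have U\<delta>: "measure lebesgue U < \<delta>" .
    have "\<forall>x. \<exists>d>0. x \<in> {a..b} - E \<longrightarrow> (\<forall>y\<in>{a..b}. \<bar>y - x\<bar> < d \<longrightarrow>
        \<bar>f y - f x - (y - x) * f' x\<bar> \<le> e1 * \<bar>y - x\<bar>)"
      using der e12(1) unfolding has_vector_derivative_def has_derivative_within_alt
      by (metis real_norm_def real_scaleR_def zero_less_one)
    then obtain d where d: "\<And>x. d x > 0" "\<And>x y. x \<in> {a..b} - E \<Longrightarrow> y \<in> {a..b} \<Longrightarrow> \<bar>y - x\<bar> < d x \<Longrightarrow>
        \<bar>f y - f x - (y - x) * f' x\<bar> \<le> e1 * \<bar>y - x\<bar>"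
      by metis
    define \<gamma> where "\<gamma> x = (if x \<in> E then U else ball x (d x))" for x
    have "gauge \<gamma>" unfolding gauge_def \<gamma>_def using U d(1) by auto
    moreover have "norm ((\<Sum>(x, K)\<in>p. measure lborel K *\<^sub>R g x) - (f b - f a)) \<le> e * measure lborel {a..b}"
      if p: "p tagged_division_of {a..b}" and fine: "\<gamma> fine p" for p
    proof -
      have fin: "finite p" using p by blast
      define q where "q = {(x, K) \<in> p. x \<in> E}"
      have "q \<subseteq> p" by (auto simp: q_def)
      have len: "\<exists>u v. K = {u..v} \<and> u \<le> v \<and> x \<in> {u..v} \<and> {u..v} \<subseteq> {a..b}" if "(x, K) \<in> p" for x K
        using tagged_division_ofD(2,3,4)[OF p that] by (metis atLeastAtMost_iff box_real(2) order_trans)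
      have good: "\<bar>measure lborel K * g x - (f (Sup K) - f (Inf K))\<bar> \<le> e1 * (Sup K - Inf K)"
        if xK: "(x, K) \<in> p - q" for x K
      proof -
        from xK have "x \<notin> E" by (auto simp: q_def)
        obtain u v where K: "K = {u..v}" "u \<le> v" "x \<in> {u..v}" "{u..v} \<subseteq> {a..b}"
          using len[of x K] xK by blast
        have "K \<subseteq> ball x (d x)" using fineD[OF fine, of x K] xK \<open>x \<notin> E\<close> by (simp add: \<gamma>_def)
        then have "\<bar>f y - f x - (y - x) * f' x\<bar> \<le> e1 * \<bar>y - x\<bar>" if "y \<in> {u..v}" for y
          using d(2)[of x y] \<open>x \<notin> E\<close> K that by (auto simp: dist_real_def abs_minus_commute)
        from straddle[OF K(3) this] show ?thesis
          using K(1,2) \<open>x \<notin> E\<close> by (simp add: g_def)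
      qed
      have q: "q tagged_partial_division_of {a..b}"
        using tagged_partial_division_subset[OF _ \<open>q \<subseteq> p\<close>] p by (auto simp: tagged_division_of_def)
      have qdiv: "snd ` q division_of \<Union>(snd ` q)"
        by (rule partial_division_of_tagged_division[OF q])
      have qsub: "\<Union>(snd ` q) \<subseteq> {a..b}" "\<Union>(snd ` q) \<subseteq> U"
      proof -
        have "K \<subseteq> {a..b} \<and> K \<subseteq> U" if "(x, K) \<in> q" for x K
          using that tagged_partial_division_ofD(3)[OF q that] fineD[OF fine, of x K]
          by (simp add: q_def \<gamma>_def)
        then show "\<Union>(snd ` q) \<subseteq> {a..b}" "\<Union>(snd ` q) \<subseteq> U" by fastforce+
      qed
      have "measure lborel K = measure lebesgue K" if "K \<in> snd ` q" for K
        using division_ofD(4)[OF qdiv that] by auto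
      then have "(\<Sum>K\<in>snd ` q. measure lborel K) = measure lebesgue (\<Union>(snd ` q))"
        using content_division[OF qdiv] by simp
      also have "\<dots> \<le> measure lebesgue U"
        using qsub(2) Ulm lmeasurable_division[OF qdiv] by (intro measure_mono_fmeasurable) auto
      finally have "(\<Sum>K\<in>snd ` q. \<bar>f (Sup K) - f (Inf K)\<bar>) < e2"
        using U\<delta> by (intro \<delta>[OF qdiv qsub(1)]) simp
      moreover have "(\<Sum>(x, K)\<in>q. \<bar>f (Sup K) - f (Inf K)\<bar>) = (\<Sum>K\<in>snd ` q. \<bar>f (Sup K) - f (Inf K)\<bar>)"
      proof -
        \<comment> \<open>Two tags may share a degenerate interval; \<open>f\<close> has no increment on it, so the sum over
          the intervals equals the sum over the tagged intervals. The value \<open>0\<close> at the empty set, where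
          \<open>Sup\<close> and \<open>Inf\<close> are arbitrary, makes \<open>\<phi>\<close> vanish on every box without interior.\<close>
        define \<phi> where "\<phi> K = (if K = {} then 0 else \<bar>f (Sup K) - f (Inf K)\<bar>)" for K
        have ne: "K \<noteq> {}" if "(x, K) \<in> q" for x K
          using tagged_partial_division_ofD(2)[OF q that] by blast
        have "(\<Sum>(x, K)\<in>q. \<phi> K) = (\<Sum>K\<in>snd ` q. \<phi> K)"
        proof (rule sum.over_tagged_division_lemma[OF tagged_partial_division_of_Union_self[OF q]])
          fix u v :: real assume "box u v = {}"
          then show "\<phi> (cbox u v) = 0"
            by (cases "u = v") (auto simp: \<phi>_def)
        qed
        moreover have "(\<Sum>(x, K)\<in>q. \<phi> K) = (\<Sum>(x, K)\<in>q. \<bar>f (Sup K) - f (Inf K)\<bar>)"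
          by (rule sum.cong) (use ne in \<open>auto simp: \<phi>_def\<close>)
        moreover have "(\<Sum>K\<in>snd ` q. \<phi> K) = (\<Sum>K\<in>snd ` q. \<bar>f (Sup K) - f (Inf K)\<bar>)"
          by (rule sum.cong) (use ne in \<open>auto simp: \<phi>_def\<close>)
        ultimately show ?thesis by simp
      qed
      ultimately have bad: "(\<Sum>(x, K)\<in>q. \<bar>f (Sup K) - f (Inf K)\<bar>) < e2" by simp
      have "(\<Sum>(x, K)\<in>p. measure lborel K *\<^sub>R g x) - (f b - f a)
          = (\<Sum>(x, K)\<in>p. measure lborel K * g x - (f (Sup K) - f (Inf K)))"
        using additive_tagged_division_1[OF \<open>a \<le> b\<close> p, of f] by (simp add: sum_subtractf split_def)
      also have "\<dots> = (\<Sum>(x, K)\<in>p - q. measure lborel K * g x - (f (Sup K) - f (Inf K)))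
          + (\<Sum>(x, K)\<in>q. measure lborel K * g x - (f (Sup K) - f (Inf K)))"
        by (rule sum.subset_diff[OF \<open>q \<subseteq> p\<close> fin])
      also have "\<bar>\<dots>\<bar> \<le> (\<Sum>(x, K)\<in>p - q. e1 * (Sup K - Inf K)) + (\<Sum>(x, K)\<in>q. \<bar>f (Sup K) - f (Inf K)\<bar>)"
      proof (rule order_trans[OF abs_triangle_ineq] add_mono)+
        show "\<bar>\<Sum>(x, K)\<in>p - q. measure lborel K * g x - (f (Sup K) - f (Inf K))\<bar> \<le> (\<Sum>(x, K)\<in>p - q. e1 * (Sup K - Inf K))"
          by (rule order_trans[OF sum_abs], rule sum_mono) (use good in auto)
        show "\<bar>\<Sum>(x, K)\<in>q. measure lborel K * g x - (f (Sup K) - f (Inf K))\<bar> \<le> (\<Sum>(x, K)\<in>q. \<bar>f (Sup K) - f (Inf K)\<bar>)"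
          by (rule order_trans[OF sum_abs], rule sum_mono) (auto simp: q_def g_def)
      qed
      also have "(\<Sum>(x, K)\<in>p - q. e1 * (Sup K - Inf K)) \<le> (\<Sum>(x, K)\<in>p. e1 * (Sup K - Inf K))"
        by (rule sum_mono2) (use fin len e12(1) in \<open>fastforce+\<close>)
      also have "\<dots> = e1 * (b - a)"
        using additive_tagged_division_1[OF \<open>a \<le> b\<close> p, of "\<lambda>x. x"]
        by (simp add: split_def sum_distrib_left[symmetric])
      finally show ?thesis using bad e12(3) by simp
    qed
    ultimately show "\<exists>\<gamma>. gauge \<gamma> \<and> (\<forall>p. p tagged_division_of {a..b} \<and> \<gamma> fine p \<longrightarrow>
        norm ((\<Sum>(x, K)\<in>p. measure lborel K *\<^sub>R g x) - (f b - f a)) \<le> e * measure lborel {a..b})"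
      by (intro exI[of _ \<gamma>] conjI allI impI) simp_all
  qed
  then show ?thesis
    by (rule has_integral_spike[OF neg, rotated]) (auto simp: g_def)
qed

lemma integration_by_parts_abs_continuous:
  fixes f g :: "real \<Rightarrow> real"
  assumes "a \<le> b" "abs_continuous_on {a..b} f" "abs_continuous_on {a..b} g" "negligible E"
    and f: "\<And>x. x \<in> {a..b} - E \<Longrightarrow> (f has_vector_derivative f' x) (at x within {a..b})"
    and g: "\<And>x. x \<in> {a..b} - E \<Longrightarrow> (g has_vector_derivative g' x) (at x within {a..b})"
  shows "((\<lambda>x. f x * g' x + f' x * g x) has_integral (f b * g b - f a * g a)) {a..b}"
proof (rule fundamental_theorem_of_calculus_abs_continuous[where f = "\<lambda>x. f x * g x"])
  show "((\<lambda>x. f x * g x) has_vector_derivative f x * g' x + f' x * g x) (at x within {a..b})"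
    if "x \<in> {a..b} - E" for x
    using f[OF that] g[OF that] by (rule has_vector_derivative_mult)
qed (use assms abs_continuous_on_mult in auto)

section \<open>Gluing translates of a function along the integers\<close>

text \<open>
  At an integer the left and the right branch of \<open>y \<mapsto> g (frac y)\<close> are two translates of \<open>g\<close>; they fit
  together differentiably as soon as the values and the slopes of \<open>g\<close> match at \<open>0\<close> and \<open>1\<close>.
\<close>

lemma frac_glue_has_derivative:
  fixes g :: "real \<Rightarrow> real"
  assumes g: "\<And>t. (g has_vector_derivative g' t) (at t)"
    and match: "g 0 = g 1" "g' 0 = g' 1"
  shows "((\<lambda>y. g (frac y)) has_vector_derivative g' (frac x)) (at x)"
proof -
  \<comment> \<open>The ceiling \<open>n\<close> of \<open>x\<close> is the only integer in the open interval from \<open>n - 1\<close> to \<open>n + 1\<close>,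
    which contains \<open>x\<close> whether or not \<open>x\<close> is an integer.\<close>
  define n where "n = \<lceil>x\<rceil>"
  have n: "of_int n - 1 < x" "x \<le> of_int n" unfolding n_def by linarith+
  let ?S = "{..<real_of_int n}" and ?T = "{real_of_int n..}"
  have shift: "((\<lambda>y. g (y - c)) has_vector_derivative g' (z - c)) (at z within A)" for c z A
  proof -
    have "((\<lambda>y. y - c) has_vector_derivative 1) (at z within A)"
      by (auto intro!: derivative_eq_intros)
    from vector_diff_chain_within[OF this has_vector_derivative_at_within[OF g[of "z - c"]]]
    show ?thesis by (simp add: o_def)
  qed
  have frac1: "frac y = y - (of_int n - 1)" if "of_int n - 1 \<le> y" "y < of_int n" for y :: real
    using that by (subst frac_unique_iff) auto
  have frac2: "frac y = y - of_int n" if "of_int n \<le> y" "y < of_int n + 1" for y :: real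
    using that by (subst frac_unique_iff) auto
  have "((\<lambda>y. if y \<in> ?S then g (y - (of_int n - 1)) else g (y - of_int n)) has_vector_derivative
      (if x \<in> ?S then g' (x - (of_int n - 1)) else g' (x - of_int n))) (at x within UNIV)"
    by (rule has_vector_derivative_If_within_closures[where T = ?T])
      (use match in \<open>auto intro!: shift\<close>)
  moreover have "(if x \<in> ?S then g' (x - (of_int n - 1)) else g' (x - of_int n)) = g' (frac x)"
    using n frac1[of x] frac2[of x] by auto
  ultimately have "((\<lambda>y. if y \<in> ?S then g (y - (of_int n - 1)) else g (y - of_int n))
      has_vector_derivative g' (frac x)) (at x)" by simp
  then show ?thesis
    by (rule has_vector_derivative_transform_within_open[where S = "{of_int n - 1<..<of_int n + 1}"])
      (use n frac1 frac2 in auto)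
qed

definition periodize :: "nat \<Rightarrow> (real \<Rightarrow> real) \<Rightarrow> real \<Rightarrow> real" where
  "periodize N g x = g (frac (real N * x))"

lemma periodize_has_derivative:
  fixes g :: "real \<Rightarrow> real"
  assumes g: "\<And>t. (g has_real_derivative g' t) (at t)"
    and match: "g 0 = g 1" "g' 0 = g' 1"
  shows "(periodize N g has_vector_derivative real N * periodize N g' x) (at x within A)"
proof -
  have "((\<lambda>y. g (frac y)) has_vector_derivative g' (frac (real N * x))) (at (real N * x))"
    using assms by (intro frac_glue_has_derivative) (auto simp: has_real_derivative_iff_has_vector_derivative)
  moreover have "((\<lambda>x. real N * x) has_vector_derivative real N) (at x within A)"
    by (auto intro!: derivative_eq_intros)
  ultimately have "((\<lambda>y. g (frac y)) \<circ> (\<lambda>x. real N * x) has_vector_derivative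
      real N *\<^sub>R g' (frac (real N * x))) (at x within A)"
    by (metis vector_diff_chain_within has_vector_derivative_at_within)
  moreover have "(\<lambda>y. g (frac y)) \<circ> (\<lambda>x. real N * x) = periodize N g"
    by (rule ext) (simp add: periodize_def)
  ultimately show ?thesis by (simp add: periodize_def[of N g'])
qed

lemma periodize_node:
  assumes "N \<ge> 1"
  shows "periodize N g (1 / real N * real \<beta>) = g 0"
proof -
  have "real N * (1 / real N * real \<beta>) = real \<beta>" using assms by simp
  moreover have "frac (real \<beta>) = 0" by (simp only: frac_eq_0_iff Ints_of_nat)
  ultimately show ?thesis by (simp only: periodize_def)
qed

text \<open>
  Subtracting its mean \<open>c\<close> from \<open>g\<close> gives a function with a periodic antiderivative, so that the
  integral over the unit interval needs no decomposition into panels.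
\<close>

lemma periodize_has_integral:
  fixes g :: "real \<Rightarrow> real"
  assumes "N \<ge> 1" and G: "\<And>t. (G has_real_derivative g t - c) (at t)"
    and match: "G 0 = G 1" "g 0 = g 1"
  shows "(periodize N g has_integral c) {0..1}"
proof -
  have "((\<lambda>x. periodize N G x / N + c * x) has_vector_derivative periodize N g x) (at x within {0..1})" for x
  proof -
    have "(periodize N G has_real_derivative real N * periodize N (\<lambda>t. g t - c) x) (at x within {0..1})"
      unfolding has_real_derivative_iff_has_vector_derivative
      by (rule periodize_has_derivative) (use G match in auto)
    then have "((\<lambda>x. periodize N G x / N + c * x) has_real_derivative
        real N * periodize N (\<lambda>t. g t - c) x / N + c) (at x within {0..1})"
      using assms(1) by (auto intro!: derivative_eq_intros)
    then show ?thesis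
      using assms(1) by (simp add: has_real_derivative_iff_has_vector_derivative periodize_def)
  qed
  then have "(periodize N g has_integral (periodize N G 1 / N + c * 1) - (periodize N G 0 / N + c * 0)) {0..1}"
    by (intro fundamental_theorem_of_calculus) auto
  moreover have "periodize N G 1 = G 0" "periodize N G 0 = G 0"
    using periodize_node[OF assms(1), of G N] periodize_node[OF assms(1), of G 0] assms(1) by simp_all
  ultimately show ?thesis by simp
qed

section \<open>The Peano kernel of the corrected trapezoidal rule\<close>

definition bernoulli_B3 :: "real \<Rightarrow> real" where
  "bernoulli_B3 t = t^3 - 3/2 * t^2 + t/2"

text \<open>
  The kernel \<open>k\<close> is the cubic with \<open>k''' = -1\<close> that vanishes at both ends and the midpoint of the panel. The
  first property produces \<open>\<integral> \<phi>\<close> after three integrations by parts, the second removes the end point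
  values of \<open>\<phi>''\<close>. The values of \<open>k''\<close> and \<open>k'\<close> at the ends are then, up to sign, the weights of \<open>\<phi>\<close> and \<open>\<phi>'\<close>. Only the
  first integration by parts involves \<open>\<phi>'''\<close> and needs absolute continuity.
\<close>

lemma peano_kernel_panel:
  fixes \<phi> :: "real \<Rightarrow> real"
  assumes h: "h > 0" and b: "b = a + h"
    and d1: "\<And>x. x \<in> {a..b} \<Longrightarrow> (\<phi> has_vector_derivative \<phi>1 x) (at x within {a..b})"
    and d2: "\<And>x. x \<in> {a..b} \<Longrightarrow> (\<phi>1 has_vector_derivative \<phi>2 x) (at x within {a..b})"
    and ac: "abs_continuous_on {a..b} \<phi>2" and neg: "negligible E"
    and d3: "\<And>x. x \<in> {a..b} - E \<Longrightarrow> (\<phi>2 has_vector_derivative \<phi>3 x) (at x within {a..b})"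
  shows "((\<lambda>x. - (h^3 / 6) * bernoulli_B3 ((x - a) / h) * \<phi>3 x) has_integral
      (integral {a..b} \<phi> - h / 2 * (\<phi> a + \<phi> b) - h^2 / 12 * (\<phi>1 a - \<phi>1 b))) {a..b}"
proof -
  define k where "k x = - (h^3 / 6) * bernoulli_B3 ((x - a) / h)" for x
  define k1 where "k1 x = - ((x - a)^2 / 2 - h * (x - a) / 2 + h^2 / 12)" for x
  define k2 where "k2 x = - ((x - a) - h / 2)" for x
  have "a \<le> b" using h b by simp
  have k: "k x = - ((x - a)^3 / 6 - h * (x - a)^2 / 4 + h^2 * (x - a) / 12)" for x
    using h by (simp add: k_def bernoulli_B3_def power_divide) (simp add: field_simps power2_eq_square power3_eq_cube)
  have dk: "(k has_vector_derivative k1 x) (at x within {a..b})" for x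
    unfolding k[abs_def] k1_def has_real_derivative_iff_has_vector_derivative[symmetric]
    by (auto intro!: derivative_eq_intros simp: field_simps power2_eq_square)
  have dk1: "(k1 has_vector_derivative k2 x) (at x within {a..b})" for x
    unfolding k1_def[abs_def] k2_def has_real_derivative_iff_has_vector_derivative[symmetric]
    by (auto intro!: derivative_eq_intros simp: field_simps power2_eq_square)
  have dk2: "(k2 has_vector_derivative - 1) (at x within {a..b})" for x
    unfolding k2_def[abs_def] has_real_derivative_iff_has_vector_derivative[symmetric]
    by (auto intro!: derivative_eq_intros)
  have "continuous_on {a..b} k1"
    unfolding k1_def by (intro continuous_intros) auto
  then have "abs_continuous_on {a..b} k"
    using dk by (intro C1_imp_abs_continuous_on)
  then have A: "((\<lambda>x. k x * \<phi>3 x + k1 x * \<phi>2 x) has_integral (k b * \<phi>2 b - k a * \<phi>2 a)) {a..b}"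
    using \<open>a \<le> b\<close> ac neg dk d3 by (intro integration_by_parts_abs_continuous[where E = E]) auto
  have B: "((\<lambda>x. k2 x * \<phi>1 x - \<phi> x - (k1 x * \<phi>2 x + k2 x * \<phi>1 x)) has_integral
      (k2 b * \<phi> b - k1 b * \<phi>1 b - (k2 a * \<phi> a - k1 a * \<phi>1 a))) {a..b}"
  proof (rule fundamental_theorem_of_calculus[OF \<open>a \<le> b\<close>])
    fix x assume x: "x \<in> {a..b}"
    have "((\<lambda>x. k2 x * \<phi> x - k1 x * \<phi>1 x) has_vector_derivative
        k2 x * \<phi>1 x + - 1 * \<phi> x - (k1 x * \<phi>2 x + k2 x * \<phi>1 x)) (at x within {a..b})"
      by (intro has_vector_derivative_diff has_vector_derivative_mult dk1 dk2 d1 d2 x)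
    then show "((\<lambda>x. k2 x * \<phi> x - k1 x * \<phi>1 x) has_vector_derivative
        k2 x * \<phi>1 x - \<phi> x - (k1 x * \<phi>2 x + k2 x * \<phi>1 x)) (at x within {a..b})"
      by simp
  qed
  have "continuous_on {a..b} \<phi>"
    using d1 by (metis continuous_on_eq_continuous_within has_vector_derivative_continuous)
  then have C: "(\<phi> has_integral integral {a..b} \<phi>) {a..b}"
    by (simp add: integrable_continuous_real integrable_integral)
  have "((\<lambda>x. k x * \<phi>3 x) has_integral (k b * \<phi>2 b - k a * \<phi>2 a
      + (k2 b * \<phi> b - k1 b * \<phi>1 b - (k2 a * \<phi> a - k1 a * \<phi>1 a)) + integral {a..b} \<phi>)) {a..b}"
    using has_integral_add[OF has_integral_add[OF A B] C] by (simp add: algebra_simps)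
  moreover have "k b * \<phi>2 b - k a * \<phi>2 a + (k2 b * \<phi> b - k1 b * \<phi>1 b - (k2 a * \<phi> a - k1 a * \<phi>1 a)) + integral {a..b} \<phi>
      = integral {a..b} \<phi> - h / 2 * (\<phi> a + \<phi> b) - h^2 / 12 * (\<phi>1 a - \<phi>1 b)"
    unfolding k k1_def k2_def b by (simp add: field_simps power2_eq_square power3_eq_cube)
  ultimately show ?thesis unfolding k_def by (simp only:)
qed

text \<open>
  The corrections at the interior nodes telescope since \<open>k'\<close> has the same value at both ends of a panel.
  Since \<open>B\<^sub>3(0) = B\<^sub>3(1)\<close>, the kernels of neighbouring panels agree at the common end point.
\<close>

lemma peano_kernel_panels:
  fixes \<phi> :: "real \<Rightarrow> real" and h :: real
  assumes N: "N \<ge> 1" and h: "h = 1 / real N"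
    and d1: "\<And>x. x \<in> {0..1} \<Longrightarrow> (\<phi> has_vector_derivative \<phi>1 x) (at x within {0..1})"
    and d2: "\<And>x. x \<in> {0..1} \<Longrightarrow> (\<phi>1 has_vector_derivative \<phi>2 x) (at x within {0..1})"
    and ac: "abs_continuous_on {0..1} \<phi>2" and neg: "negligible E"
    and d3: "\<And>x. x \<in> {0..1} - E \<Longrightarrow> (\<phi>2 has_vector_derivative \<phi>3 x) (at x within {0..1})"
    and n: "n \<le> N"
  shows "((\<lambda>x. - (h^3 / 6) * periodize N bernoulli_B3 x * \<phi>3 x) has_integral
      (integral {0..h * n} \<phi> - (\<Sum>\<beta><n. h / 2 * (\<phi> (h * \<beta>) + \<phi> (h * Suc \<beta>)))
        - h^2 / 12 * (\<phi>1 0 - \<phi>1 (h * n)))) {0..h * n}"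
  using n
proof (induction n)
  case 0
  then show ?case by (simp add: has_integral_refl)
next
  case (Suc n)
  let ?a = "h * n" and ?b = "h * Suc n"
  have h0: "h > 0" using N h by simp
  have "?b \<le> h * real N" using Suc.prems h0 by (intro mult_left_mono) auto
  then have sub: "{?a..?b} \<subseteq> {0..1}" "?b \<le> 1" using h0 N h by auto
  have le: "0 \<le> ?a" "?a \<le> ?b" using h0 by auto
  note sub' = sub(1)[THEN subsetD] has_vector_derivative_within_subset[OF _ sub(1)]
  have "((\<lambda>x. - (h^3 / 6) * bernoulli_B3 ((x - ?a) / h) * \<phi>3 x) has_integral
      (integral {?a..?b} \<phi> - h / 2 * (\<phi> ?a + \<phi> ?b) - h^2 / 12 * (\<phi>1 ?a - \<phi>1 ?b))) {?a..?b}"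
  proof (rule peano_kernel_panel[OF h0 _ _ _ _ neg])
    show "?b = ?a + h" by (simp add: algebra_simps)
    show "abs_continuous_on {?a..?b} \<phi>2" by (rule abs_continuous_on_subset[OF ac sub(1)])
    show "(\<phi> has_vector_derivative \<phi>1 x) (at x within {?a..?b})" if "x \<in> {?a..?b}" for x
      using sub' d1 that by blast
    show "(\<phi>1 has_vector_derivative \<phi>2 x) (at x within {?a..?b})" if "x \<in> {?a..?b}" for x
      using sub' d2 that by blast
    show "(\<phi>2 has_vector_derivative \<phi>3 x) (at x within {?a..?b})" if "x \<in> {?a..?b} - E" for x
      using sub' d3 that by blast
  qed
  moreover have "periodize N bernoulli_B3 x = bernoulli_B3 ((x - ?a) / h)" if "x \<in> {?a..?b}" for x
  proof (cases "x = ?b")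
    case True
    then have "periodize N bernoulli_B3 x = bernoulli_B3 0" using periodize_node[OF N, of bernoulli_B3 "Suc n"] h by simp
    also have "\<dots> = bernoulli_B3 1" by (simp add: bernoulli_B3_def)
    finally show ?thesis using True h0 by (simp add: field_simps)
  next
    case False
    then have "?a \<le> x" "x < ?b" using that by auto
    then have "real N * ?a \<le> real N * x" "real N * x < real N * ?b"
      using N by (auto intro: mult_left_mono mult_strict_left_mono)
    moreover have "real N * ?a = n" "real N * ?b = n + 1" using N h by simp_all
    ultimately have "n \<le> real N * x" "real N * x < n + 1" by linarith+
    then have "frac (real N * x) = real N * x - n"
      by (subst frac_unique_iff) auto
    also have "\<dots> = (x - ?a) / h" unfolding h using N by (simp add: field_simps)
    finally have "frac (real N * x) = (x - ?a) / h" .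
    then show ?thesis by (simp add: periodize_def)
  qed
  ultimately have "((\<lambda>x. - (h^3 / 6) * periodize N bernoulli_B3 x * \<phi>3 x) has_integral
      (integral {?a..?b} \<phi> - h / 2 * (\<phi> ?a + \<phi> ?b) - h^2 / 12 * (\<phi>1 ?a - \<phi>1 ?b))) {?a..?b}"
    by (subst has_integral_cong) auto
  from has_integral_combine[OF le Suc.IH this]
  have *: "((\<lambda>x. - (h^3 / 6) * periodize N bernoulli_B3 x * \<phi>3 x) has_integral
      (integral {0..?a} \<phi> - (\<Sum>\<beta><n. h / 2 * (\<phi> (h * \<beta>) + \<phi> (h * Suc \<beta>))) - h^2 / 12 * (\<phi>1 0 - \<phi>1 ?a)
      + (integral {?a..?b} \<phi> - h / 2 * (\<phi> ?a + \<phi> ?b) - h^2 / 12 * (\<phi>1 ?a - \<phi>1 ?b)))) {0..?b}"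
    using Suc.prems by simp
  have "continuous_on {0..1} \<phi>"
    using d1 by (metis continuous_on_eq_continuous_within has_vector_derivative_continuous)
  then have "\<phi> integrable_on {0..?b}"
    using sub le by (intro integrable_continuous_real) (auto elim!: continuous_on_subset)
  then have **: "integral {0..?b} \<phi> = integral {0..?a} \<phi> + integral {?a..?b} \<phi>"
    by (rule Henstock_Kurzweil_Integration.integral_combine[OF le, symmetric])
  have ends: "h^2 / 12 * (\<phi>1 0 - \<phi>1 ?b) = h^2 / 12 * (\<phi>1 0 - \<phi>1 ?a) + h^2 / 12 * (\<phi>1 ?a - \<phi>1 ?b)"
    by (simp add: right_diff_distrib)
  have regroup: "I - (S + T) - D = I1 - S - D1 + (I2 - T - D2)"
    if "I = I1 + I2" "D = D1 + D2" for I I1 I2 S T D D1 D2 :: real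
    using that by simp
  show ?case
    unfolding sum.lessThan_Suc by (rule has_integral_eq_rhs[OF * regroup[OF ** ends]])
qed

lemma trapezoid_sum:
  fixes f :: "nat \<Rightarrow> real"
  assumes "N \<ge> 1"
  shows "(\<Sum>\<beta><N. h / 2 * (f \<beta> + f (Suc \<beta>))) = (\<Sum>\<beta>=0..N. (if \<beta> = 0 \<or> \<beta> = N then h / 2 else h) * f \<beta>)"
proof -
  have "(\<Sum>\<beta>=0..N. (if \<beta> = 0 \<or> \<beta> = N then h / 2 else h) * f \<beta>)
      = (\<Sum>\<beta>=0..N. h * f \<beta> - (if \<beta> = 0 then h / 2 * f \<beta> else 0) - (if \<beta> = N then h / 2 * f \<beta> else 0))"
    using assms by (intro sum.cong) auto
  also have "\<dots> = h * (\<Sum>\<beta>\<le>N. f \<beta>) - h / 2 * f 0 - h / 2 * f N"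
    by (simp add: sum_subtractf sum_distrib_left atLeast0AtMost)
  finally have 1: "(\<Sum>\<beta>=0..N. (if \<beta> = 0 \<or> \<beta> = N then h / 2 else h) * f \<beta>)
      = h * (\<Sum>\<beta>\<le>N. f \<beta>) - h / 2 * f 0 - h / 2 * f N" .
  have 2: "(\<Sum>\<beta><N. f \<beta>) = (\<Sum>\<beta>\<le>N. f \<beta>) - f N"
    using sum.lessThan_Suc[of f N] by (simp add: lessThan_Suc_atMost)
  have 3: "(\<Sum>\<beta><N. f (Suc \<beta>)) = (\<Sum>\<beta>\<le>N. f \<beta>) - f 0"
    using sum.lessThan_Suc_shift[of f N] by (simp add: lessThan_Suc_atMost)
  have "(\<Sum>\<beta><N. h / 2 * (f \<beta> + f (Suc \<beta>))) = h / 2 * ((\<Sum>\<beta><N. f \<beta>) + (\<Sum>\<beta><N. f (Suc \<beta>)))"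
    by (simp only: sum_distrib_left[symmetric] sum.distrib)
  also have "\<dots> = h * (\<Sum>\<beta>\<le>N. f \<beta>) - h / 2 * f 0 - h / 2 * f N"
    unfolding 2 3 by (simp add: algebra_simps)
  finally show ?thesis unfolding 1 .
qed

text \<open>
  The exceptional null set of the kernel representation is the set on which the
  absolutely continuous second derivative fails to be differentiable.
\<close>

theorem corrected_trapezoid_peano:
  fixes h :: real
  assumes N: "N \<ge> 1" and h: "h = 1 / real N" and \<phi>: "\<phi> \<in> L23"
    and C: "\<And>\<beta>. \<beta> \<in> {0..N} \<Longrightarrow> C \<beta> = (if \<beta> = 0 \<or> \<beta> = N then h / 2 else h)"
  shows "((\<lambda>x. - (h^3 / 6) * periodize N bernoulli_B3 x * D01 (D01 (D01 \<phi>)) x) has_integral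
      error_functional N C (h\<^sup>2 / 12) (- (h\<^sup>2 / 12)) \<phi>) {0..1}"
proof -
  have D: "(f has_vector_derivative D01 f x) (at x within {0..1})"
    if "f differentiable (at x within {0..1})" for f x
    using that unfolding D01_def vector_derivative_works .
  have "AE x in lebesgue_on {0..1}. D01 (D01 \<phi>) differentiable (at x within {0..1})"
    using \<phi> by (simp add: L23_def)
  then have "AE x in lebesgue. x \<in> {0..1} \<longrightarrow> D01 (D01 \<phi>) differentiable (at x within {0..1})"
    by (subst (asm) AE_restrict_space_iff) auto
  then obtain E where E: "negligible E"
    "\<And>x. x \<in> {0..1} - E \<Longrightarrow> D01 (D01 \<phi>) differentiable (at x within {0..1})"
    unfolding eventually_ae_filter negligible_iff_null_sets by auto
  have hN: "h * real N = 1" using N h by simp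
  have "((\<lambda>x. - (h^3 / 6) * periodize N bernoulli_B3 x * D01 (D01 (D01 \<phi>)) x) has_integral
      (integral {0..h * N} \<phi> - (\<Sum>\<beta><N. h / 2 * (\<phi> (h * \<beta>) + \<phi> (h * Suc \<beta>)))
        - h^2 / 12 * (D01 \<phi> 0 - D01 \<phi> (h * N)))) {0..h * N}"
    by (rule peano_kernel_panels[OF N h, where E = E]) (use \<phi> E D in \<open>auto simp: L23_def\<close>)
  then have "((\<lambda>x. - (h^3 / 6) * periodize N bernoulli_B3 x * D01 (D01 (D01 \<phi>)) x) has_integral
      (integral {0..1} \<phi> - (\<Sum>\<beta><N. h / 2 * (\<phi> (h * \<beta>) + \<phi> (h * Suc \<beta>)))
        - h^2 / 12 * (D01 \<phi> 0 - D01 \<phi> 1))) {0..1}"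
    unfolding hN .
  moreover have "(\<Sum>\<beta><N. h / 2 * (\<phi> (h * \<beta>) + \<phi> (h * Suc \<beta>))) = (\<Sum>\<beta>=0..N. C \<beta> * \<phi> (1 / real N * real \<beta>))"
    unfolding trapezoid_sum[OF N, of h "\<lambda>\<beta>. \<phi> (h * real \<beta>)"]
    by (intro sum.cong refl) (simp add: C flip: h)
  moreover have "I - S - h\<^sup>2 / 12 * (D - D') = I - S - h\<^sup>2 / 12 * D - - (h\<^sup>2 / 12) * D'" for I S D D' :: real
    by (simp add: right_diff_distrib)
  ultimately show ?thesis by (simp only: error_functional_def)
qed

section \<open>Smooth members of the Sobolev space\<close>

text \<open>
  The test functions of the proof, splines and polynomials, come with explicit derivatives. Carrying
  these along avoids computing with iterated \<open>D01\<close>, whose values outside the unit interval are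
  of no meaning.
\<close>

definition C3_on_unit :: "(real \<Rightarrow> real) \<Rightarrow> (real \<Rightarrow> real) \<Rightarrow> (real \<Rightarrow> real) \<Rightarrow> (real \<Rightarrow> real) \<Rightarrow> bool" where
  "C3_on_unit f f1 f2 f3 \<longleftrightarrow>
     (\<forall>x\<in>{0..1}. (f has_vector_derivative f1 x) (at x within {0..1})) \<and>
     (\<forall>x\<in>{0..1}. (f1 has_vector_derivative f2 x) (at x within {0..1})) \<and>
     (\<forall>x\<in>{0..1}. (f2 has_vector_derivative f3 x) (at x within {0..1})) \<and>
     continuous_on {0..1} f3"

lemma C3_on_unit_lincomb:
  assumes "C3_on_unit f f1 f2 f3" "C3_on_unit g g1 g2 g3"
  shows "C3_on_unit (\<lambda>x. c * f x + t * g x) (\<lambda>x. c * f1 x + t * g1 x)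
    (\<lambda>x. c * f2 x + t * g2 x) (\<lambda>x. c * f3 x + t * g3 x)"
  using assms unfolding C3_on_unit_def
  by (auto intro!: has_vector_derivative_add has_vector_derivative_mult_right continuous_intros)

lemma C3_on_unit_poly:
  "C3_on_unit (poly p) (poly (pderiv p)) (poly (pderiv (pderiv p))) (poly (pderiv (pderiv (pderiv p))))"
  unfolding C3_on_unit_def
  by (auto simp flip: has_real_derivative_iff_has_vector_derivative intro: poly_DERIV has_field_derivative_at_within continuous_intros)

lemma D01_eqI:
  assumes "(f has_vector_derivative D) (at x within {0..1})" "x \<in> {0..1}"
  shows "D01 f x = D"
  unfolding D01_def using vector_derivative_within_closed_interval[OF _ assms(2,1)] by simp

lemma C3_on_unit_L23:
  assumes "C3_on_unit f f1 f2 f3"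
  shows C3_on_unit_in_L23: "f \<in> L23"
    and C3_on_unit_seminorm: "L23_seminorm f = sqrt (integral {0..1} (\<lambda>x. (f3 x)\<^sup>2))"
    and C3_on_unit_D01: "x \<in> {0..1} \<Longrightarrow> D01 f x = f1 x"
    and C3_on_unit_integrable: "f integrable_on {0..1}"
proof -
  have d: "(f has_vector_derivative f1 x) (at x within {0..1})"
    "(f1 has_vector_derivative f2 x) (at x within {0..1})"
    "(f2 has_vector_derivative f3 x) (at x within {0..1})" if "x \<in> {0..1}" for x
    using assms that by (auto simp: C3_on_unit_def)
  have cont: "continuous_on {0..1} f3" using assms by (simp add: C3_on_unit_def)
  have e1: "D01 f x = f1 x" if "x \<in> {0..1}" for x using d(1)[OF that] that by (rule D01_eqI)
  have d1: "(D01 f has_vector_derivative f2 x) (at x within {0..1})" if "x \<in> {0..1}" for x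
    by (rule has_vector_derivative_transform[OF that e1 d(2)[OF that]])
  have e2: "D01 (D01 f) x = f2 x" if "x \<in> {0..1}" for x using d1[OF that] that by (rule D01_eqI)
  have d2: "(D01 (D01 f) has_vector_derivative f3 x) (at x within {0..1})" if "x \<in> {0..1}" for x
    by (rule has_vector_derivative_transform[OF that e2 d(3)[OF that]])
  have e3: "D01 (D01 (D01 f)) x = f3 x" if "x \<in> {0..1}" for x using d2[OF that] that by (rule D01_eqI)
  have cont': "continuous_on {0..1} (D01 (D01 (D01 f)))"
    using cont e3 by (subst continuous_on_cong[OF refl, of _ _ f3]) auto
  then have sq: "integrable (lebesgue_on {0..1}) (\<lambda>x. (D01 (D01 (D01 f)) x)\<^sup>2)"
    by (intro continuous_imp_integrable_real continuous_intros)
  have diff: "g differentiable (at x within {0..1})"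
    if "(g has_vector_derivative D) (at x within {0..1})" for g :: "real \<Rightarrow> real" and D x
    using that unfolding has_vector_derivative_def differentiable_def by blast
  have "AE x in lebesgue_on {0..1}. D01 (D01 f) differentiable (at x within {0..1})"
    by (rule AE_I2) (use diff[OF d2] in auto)
  moreover have "D01 (D01 (D01 f)) \<in> borel_measurable (lebesgue_on {0..1})"
    using cont' by (rule continuous_imp_measurable_on_sets_lebesgue) simp
  moreover have "abs_continuous_on {0..1} (D01 (D01 f))"
    using C1_imp_abs_continuous_on[OF d2 cont] by blast
  ultimately show "f \<in> L23"
    unfolding L23_def using sq diff[OF d(1)] diff[OF d1] by simp
  have "integral\<^sup>L (lebesgue_on {0..1}) (\<lambda>x. (D01 (D01 (D01 f)) x)\<^sup>2)
      = integral {0..1} (\<lambda>x. (D01 (D01 (D01 f)) x)\<^sup>2)"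
    using sq by (rule lebesgue_integral_eq_integral) simp
  also have "\<dots> = integral {0..1} (\<lambda>x. (f3 x)\<^sup>2)"
    by (rule Henstock_Kurzweil_Integration.integral_cong) (simp add: e3)
  finally show "L23_seminorm f = sqrt (integral {0..1} (\<lambda>x. (f3 x)\<^sup>2))"
    by (simp add: L23_seminorm_def)
  show "x \<in> {0..1} \<Longrightarrow> D01 f x = f1 x" by (rule e1)
  have "continuous_on {0..1} f"
    using d(1) by (metis continuous_on_eq_continuous_within has_vector_derivative_continuous)
  then show "f integrable_on {0..1}" by (rule integrable_continuous_real)
qed

lemma error_functional_lincomb:
  assumes f: "C3_on_unit f f1 f2 f3" and g: "C3_on_unit g g1 g2 g3"
  shows "error_functional N C A B (\<lambda>x. c * f x + t * g x)
    = c * error_functional N C A B f + t * error_functional N C A B g"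
proof -
  have "integral {0..1} (\<lambda>x. c * f x + t * g x) = c * integral {0..1} f + t * integral {0..1} g"
    using C3_on_unit_integrable[OF f] C3_on_unit_integrable[OF g]
    by (subst Henstock_Kurzweil_Integration.integral_add) (auto intro: integrable_on_mult_right)
  moreover have "D01 (\<lambda>x. c * f x + t * g x) x = c * D01 f x + t * D01 g x" if "x \<in> {0..1}" for x
    using C3_on_unit_D01[OF C3_on_unit_lincomb[OF f g] that] C3_on_unit_D01[OF f that]
      C3_on_unit_D01[OF g that] by simp
  ultimately show ?thesis
    by (simp add: error_functional_def sum.distrib sum_distrib_left algebra_simps)
qed

text \<open>
  The supremum in the norm runs over functions of seminorm one only; rescaling turns
  any test function of positive seminorm into a lower bound.
\<close>

lemma error_norm_lower:
  assumes f: "C3_on_unit f f1 f2 f3" and S: "integral {0..1} (\<lambda>x. (f3 x)\<^sup>2) = S" "S > 0"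
  shows "ereal (\<bar>error_functional N C A B f\<bar> / sqrt S) \<le> error_norm N C A B"
proof -
  define c where "c = 1 / sqrt S"
  have "c > 0" using S by (simp add: c_def)
  \<comment> \<open>The zero summand lets the rules for linear combinations serve for scaling.\<close>
  let ?g = "\<lambda>x. c * f x + 0 * f x"
  note g = C3_on_unit_lincomb[OF f f, of c 0]
  have "integral {0..1} (\<lambda>x. (c * f3 x + 0 * f3 x)\<^sup>2) = c\<^sup>2 * S"
    using S by (simp add: power_mult_distrib)
  then have "L23_seminorm ?g = 1"
    using C3_on_unit_seminorm[OF g] S by (simp add: c_def power_divide)
  then have "ereal \<bar>error_functional N C A B ?g\<bar> \<le> error_norm N C A B"
    unfolding error_norm_def using C3_on_unit_in_L23[OF g] by (intro SUP_upper) simp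
  moreover have "\<bar>error_functional N C A B ?g\<bar> = \<bar>error_functional N C A B f\<bar> / sqrt S"
    unfolding error_functional_lincomb[OF f f] using \<open>c > 0\<close> by (simp add: abs_mult c_def)
  ultimately show ?thesis by simp
qed

section \<open>An upper bound for the norm of the corrected trapezoidal rule\<close>

lemma L23_third_derivative:
  assumes "\<phi> \<in> L23"
  shows "((\<lambda>x. (D01 (D01 (D01 \<phi>)) x)\<^sup>2) has_integral (L23_seminorm \<phi>)\<^sup>2) {0..1}"
proof -
  have i: "integrable (lebesgue_on {0..1}) (\<lambda>x. (D01 (D01 (D01 \<phi>)) x)\<^sup>2)"
    using assms by (simp add: L23_def)
  have "integral\<^sup>L (lebesgue_on {0..1}) (\<lambda>x. (D01 (D01 (D01 \<phi>)) x)\<^sup>2) \<ge> 0"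
    by (rule Bochner_Integration.integral_nonneg) simp
  then show ?thesis
    using has_integral_integral_lebesgue_on[OF i] by (simp add: L23_seminorm_def)
qed

lemma periodize_bernoulli_B3_square_has_integral:
  assumes "N \<ge> 1"
  shows "((\<lambda>x. (periodize N bernoulli_B3 x)\<^sup>2) has_integral 1 / 840) {0..1}"
proof -
  have "(periodize N (\<lambda>t. (bernoulli_B3 t)\<^sup>2) has_integral 1 / 840) {0..1}"
    by (rule periodize_has_integral[OF assms,
        where G = "\<lambda>t. t^7 / 7 - t^6 / 2 + 13/20 * t^5 - 3/8 * t^4 + t^3 / 12 - t / 840"])
      (auto intro!: derivative_eq_intros simp: bernoulli_B3_def field_simps power2_eq_square eval_nat_numeral)
  then show ?thesis by (simp add: periodize_def[abs_def])
qed

text \<open>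
  Instead of the Cauchy--Schwarz inequality, the pointwise bound
  \<open>\<bar>K \<phi>'''\<bar> \<le> K\<^sup>2 / (2 m) + m \<phi>'''\<^sup>2 / 2\<close> is integrated, where \<open>m\<^sup>2 = \<integral> K\<^sup>2\<close>.
  For \<open>\<phi>\<close> of seminorm one both halves contribute \<open>m/2\<close>.
\<close>

theorem corrected_trapezoid_error_norm_le:
  fixes h :: real
  assumes N: "N \<ge> 1" and h: "h = 1 / real N"
    and C: "\<And>\<beta>. \<beta> \<in> {0..N} \<Longrightarrow> C \<beta> = (if \<beta> = 0 \<or> \<beta> = N then h / 2 else h)"
  shows "error_norm N C (h\<^sup>2 / 12) (- (h\<^sup>2 / 12)) \<le> ereal (sqrt (h^6 / 30240))"
  unfolding error_norm_def
proof (rule SUP_least)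
  fix \<phi> assume "\<phi> \<in> {\<phi> \<in> L23. L23_seminorm \<phi> = 1}"
  then have \<phi>: "\<phi> \<in> L23" "L23_seminorm \<phi> = 1" by auto
  define K where "K x = - (h^3 / 6) * periodize N bernoulli_B3 x" for x
  define D where "D = D01 (D01 (D01 \<phi>))"
  define l where "l = error_functional N C (h\<^sup>2 / 12) (- (h\<^sup>2 / 12)) \<phi>"
  define m where "m = sqrt (h^6 / 30240)"
  have "h > 0" using N h by simp
  then have m: "m > 0" "m\<^sup>2 = h^6 / 30240" by (auto simp: m_def)
  have l: "((\<lambda>x. K x * D x) has_integral l) {0..1}"
    unfolding K_def D_def l_def by (rule corrected_trapezoid_peano[OF N h \<phi>(1) C])
  have D2: "((\<lambda>x. (D x)\<^sup>2) has_integral 1) {0..1}"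
    using L23_third_derivative[OF \<phi>(1)] \<phi>(2) by (simp add: D_def)
  have "((\<lambda>x. (h^3 / 6)\<^sup>2 * (periodize N bernoulli_B3 x)\<^sup>2) has_integral (h^3 / 6)\<^sup>2 * (1 / 840)) {0..1}"
    by (intro has_integral_mult_right periodize_bernoulli_B3_square_has_integral[OF N])
  moreover have "(h^3 / 6)\<^sup>2 * (1 / 840) = m\<^sup>2"
    by (simp add: m power_divide flip: power_mult)
  moreover have "(\<lambda>x. (h^3 / 6)\<^sup>2 * (periodize N bernoulli_B3 x)\<^sup>2) = (\<lambda>x. (K x)\<^sup>2)"
    unfolding K_def power_mult_distrib power2_minus ..
  ultimately have K2: "((\<lambda>x. (K x)\<^sup>2) has_integral m\<^sup>2) {0..1}"
    by (simp only:)
  have B: "((\<lambda>x. (K x)\<^sup>2 * (1 / (2 * m)) + (D x)\<^sup>2 * (m / 2)) has_integral m\<^sup>2 * (1 / (2 * m)) + 1 * (m / 2)) {0..1}"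
    by (intro has_integral_add has_integral_mult_left K2 D2)
  have "m\<^sup>2 * (1 / (2 * m)) + 1 * (m / 2) = m" using m by (simp add: power2_eq_square)
  with B have B: "((\<lambda>x. (K x)\<^sup>2 * (1 / (2 * m)) + (D x)\<^sup>2 * (m / 2)) has_integral m) {0..1}" by simp
  have young: "\<bar>u * v\<bar> \<le> u\<^sup>2 * (1 / (2 * m)) + v\<^sup>2 * (m / 2)" for u v :: real
  proof -
    have "0 \<le> (\<bar>u\<bar> - m * \<bar>v\<bar>)\<^sup>2" by simp
    then show ?thesis using m by (simp add: abs_mult field_simps power2_eq_square)
  qed
  have "l \<le> m"
    by (rule has_integral_le[OF l B]) (use young in \<open>auto simp: abs_le_iff\<close>)
  moreover have "- l \<le> m"
    by (rule has_integral_le[OF has_integral_neg[OF l] B]) (use young in \<open>auto simp: abs_le_iff\<close>)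
  ultimately show "ereal \<bar>error_functional N C (h\<^sup>2 / 12) (- (h\<^sup>2 / 12)) \<phi>\<bar> \<le> ereal (sqrt (h^6 / 30240))"
    by (simp add: l_def m_def)
qed

section \<open>The extremal spline and the lower bound\<close>

text \<open>
  The periodic spline built from \<open>B\<^sub>6(t) - B\<^sub>6(0)\<close>, and below its first two derivatives, built from
  \<open>6 B\<^sub>5\<close> and \<open>30 B\<^sub>4\<close>; the third is built from \<open>120 B\<^sub>3\<close>.
\<close>

definition extremal :: "nat \<Rightarrow> real \<Rightarrow> real" where
  "extremal N = periodize N (\<lambda>t. t^6 - 3 * t^5 + 5/2 * t^4 - t^2 / 2)"

definition extremal1 :: "nat \<Rightarrow> real \<Rightarrow> real" where
  "extremal1 N x = real N * periodize N (\<lambda>t. 6 * t^5 - 15 * t^4 + 10 * t^3 - t) x"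

definition extremal2 :: "nat \<Rightarrow> real \<Rightarrow> real" where
  "extremal2 N x = real N ^ 2 * periodize N (\<lambda>t. 30 * t^4 - 60 * t^3 + 30 * t^2 - 1) x"

lemma extremal_C3:
  "C3_on_unit (extremal N) (extremal1 N) (extremal2 N) (\<lambda>x. 120 * real N ^ 3 * periodize N bernoulli_B3 x)"
proof -
  have d0: "(extremal N has_vector_derivative extremal1 N x) (at x within {0..1})" for x
    unfolding extremal_def extremal1_def
    by (rule periodize_has_derivative) (auto intro!: derivative_eq_intros simp: field_simps eval_nat_numeral)
  have "(periodize N (\<lambda>t. 6 * t^5 - 15 * t^4 + 10 * t^3 - t) has_vector_derivative
      real N * periodize N (\<lambda>t. 30 * t^4 - 60 * t^3 + 30 * t^2 - 1) x) (at x within {0..1})" for x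
    by (rule periodize_has_derivative) (auto intro!: derivative_eq_intros simp: field_simps eval_nat_numeral)
  from has_vector_derivative_mult_right[OF this, of "real N"]
  have d1: "(extremal1 N has_vector_derivative extremal2 N x) (at x within {0..1})" for x
    by (simp add: extremal1_def[abs_def] extremal2_def power2_eq_square mult.assoc)
  have "(periodize N (\<lambda>t. 30 * t^4 - 60 * t^3 + 30 * t^2 - 1) has_vector_derivative
      real N * periodize N (\<lambda>t. 120 * bernoulli_B3 t) x) (at x within {0..1})" for x
    by (rule periodize_has_derivative) (auto intro!: derivative_eq_intros simp: bernoulli_B3_def field_simps eval_nat_numeral)
  from has_vector_derivative_mult_right[OF this, of "real N ^ 2"]
  have d2: "(extremal2 N has_vector_derivative 120 * real N ^ 3 * periodize N bernoulli_B3 x) (at x within {0..1})" for x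
    by (simp add: extremal2_def[abs_def] periodize_def power2_eq_square power3_eq_cube mult_ac)
  have "(periodize N bernoulli_B3 has_vector_derivative real N * periodize N (\<lambda>t. 3 * t^2 - 3 * t + 1/2) x) (at x within {0..1})" for x
    by (rule periodize_has_derivative) (auto intro!: derivative_eq_intros simp: bernoulli_B3_def[abs_def] field_simps eval_nat_numeral)
  then have "continuous_on {0..1} (periodize N bernoulli_B3)"
    unfolding continuous_on_eq_continuous_within by (auto intro: has_vector_derivative_continuous)
  then show ?thesis
    unfolding C3_on_unit_def using d0 d1 d2 by (auto intro!: continuous_intros)
qed

text \<open>
  The polynomials \<open>B\<^sub>6 - B\<^sub>6(0)\<close> and \<open>B\<^sub>5\<close> vanish at \<open>0\<close> and \<open>1\<close>, so the quadrature sum of the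
  spline is zero whatever the coefficients are, and the error is the integral \<open>-B\<^sub>6(0) = -1/42\<close>.
\<close>

lemma error_functional_extremal:
  assumes N: "N \<ge> 1"
  shows "error_functional N C A B (extremal N) = - 1 / 42"
proof -
  have "(extremal N has_integral - 1 / 42) {0..1}"
    unfolding extremal_def
    by (rule periodize_has_integral[OF N, where G = "\<lambda>t. t^7 / 7 - t^6 / 2 + t^5 / 2 - t^3 / 6 + t / 42"])
      (auto intro!: derivative_eq_intros simp: field_simps eval_nat_numeral)
  then have "integral {0..1} (extremal N) = - 1 / 42" by (rule integral_unique)
  moreover have "extremal N (1 / real N * real \<beta>) = 0" for \<beta>
    unfolding extremal_def by (subst periodize_node[OF N]) simp
  moreover have "extremal1 N (1 / real N * real \<beta>) = 0" for \<beta>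
    unfolding extremal1_def by (subst periodize_node[OF N]) simp
  from this[of 0] this[of N] have "D01 (extremal N) 0 = 0" "D01 (extremal N) 1 = 0"
    using C3_on_unit_D01[OF extremal_C3, of 0 N] C3_on_unit_D01[OF extremal_C3, of 1 N] N by simp_all
  ultimately show ?thesis by (simp add: error_functional_def)
qed

lemma extremal_energy:
  assumes N: "N \<ge> 1"
  shows "integral {0..1} (\<lambda>x. (120 * real N ^ 3 * periodize N bernoulli_B3 x)\<^sup>2) = 120 / 7 * real N ^ 6"
proof -
  have "((\<lambda>x. (120 * real N ^ 3)\<^sup>2 * (periodize N bernoulli_B3 x)\<^sup>2) has_integral (120 * real N ^ 3)\<^sup>2 * (1 / 840)) {0..1}"
    by (intro has_integral_mult_right periodize_bernoulli_B3_square_has_integral[OF N])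
  then have "integral {0..1} (\<lambda>x. (120 * real N ^ 3)\<^sup>2 * (periodize N bernoulli_B3 x)\<^sup>2) = (120 * real N ^ 3)\<^sup>2 * (1 / 840)"
    by (rule integral_unique)
  then show ?thesis by (simp add: power_mult_distrib flip: power_mult)
qed

lemma error_norm_ge:
  fixes h :: real
  assumes N: "N \<ge> 1" and h: "h = 1 / real N"
  shows "ereal (sqrt (h^6 / 30240)) \<le> error_norm N C A B"
proof -
  have "120 / 7 * real N ^ 6 > 0" using N by simp
  from error_norm_lower[OF extremal_C3 extremal_energy[OF N] this, of N C A B]
  have "ereal (1 / 42 / sqrt (120 / 7 * real N ^ 6)) \<le> error_norm N C A B"
    by (simp add: error_functional_extremal[OF N])
  moreover have "1 / 42 / sqrt (120 / 7 * real N ^ 6) = sqrt (h^6 / 30240)"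
  proof -
    have "1 / 42 / sqrt (120 / 7 * real N ^ 6) = sqrt ((1 / 42)\<^sup>2 / (120 / 7 * real N ^ 6))"
      unfolding real_sqrt_divide[of "(1 / 42)\<^sup>2"] real_sqrt_abs by simp
    also have "(1 / 42)\<^sup>2 / (120 / 7 * real N ^ 6) = h^6 / 30240"
      by (simp add: h power_divide)
    finally show ?thesis .
  qed
  ultimately show ?thesis by simp
qed

section \<open>Uniqueness of the optimal coefficients\<close>

text \<open>
  The factor \<open>42\<close> is the inverse of the value \<open>1/42\<close> of \<open>\<bar>l(u)\<bar>\<close>. The variational argument uses only that
  the norm bound is attained at the extremal spline, which makes \<open>t = 0\<close> a minimum of the function \<open>r\<close> below.
\<close>

lemma error_functional_determined:
  fixes h :: real
  assumes N: "N \<ge> 1" and h: "h = 1 / real N"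
    and le: "error_norm N C A B \<le> ereal (sqrt (h^6 / 30240))"
    and g: "C3_on_unit g g1 g2 g3"
  shows "error_functional N C A B g =
    - 42 * (h^6 / 30240) * integral {0..1} (\<lambda>x. 120 * real N ^ 3 * periodize N bernoulli_B3 x * g3 x)"
proof -
  define u3 where "u3 x = 120 * real N ^ 3 * periodize N bernoulli_B3 x" for x
  define L where "L = error_functional N C A B g"
  define M where "M = h^6 / 30240"
  define n s q where "n = 120 / 7 * real N ^ 6"
    and "s = integral {0..1} (\<lambda>x. u3 x * g3 x)" and "q = integral {0..1} (\<lambda>x. (g3 x)\<^sup>2)"
  have cont: "continuous_on {0..1} u3" "continuous_on {0..1} g3"
    using extremal_C3[of N] g by (auto simp: C3_on_unit_def u3_def[abs_def])
  have n: "n > 0" "integral {0..1} (\<lambda>x. (u3 x)\<^sup>2) = n" "M * n = (1 / 42)\<^sup>2"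
    using N extremal_energy[OF N] by (auto simp: n_def u3_def M_def h power_divide)
  have M: "M \<ge> 0" by (simp add: M_def h)
  define S where "S t = n + 2 * t * s + t\<^sup>2 * q" for t
  have energy: "integral {0..1} (\<lambda>x. (1 * u3 x + t * g3 x)\<^sup>2) = S t" for t
  proof -
    have "((\<lambda>x. (u3 x)\<^sup>2 + (2 * t) * (u3 x * g3 x) + t\<^sup>2 * (g3 x)\<^sup>2) has_integral
        integral {0..1} (\<lambda>x. (u3 x)\<^sup>2) + (2 * t) * s + t\<^sup>2 * q) {0..1}"
      unfolding s_def q_def using cont
      by (intro has_integral_add has_integral_mult_right integrable_integral
          integrable_continuous_real continuous_intros)
    then have "integral {0..1} (\<lambda>x. (u3 x)\<^sup>2 + (2 * t) * (u3 x * g3 x) + t\<^sup>2 * (g3 x)\<^sup>2) = S t"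
      unfolding n S_def by (rule integral_unique)
    then show ?thesis by (simp add: power2_sum power_mult_distrib algebra_simps)
  qed
  have bound: "(- 1 / 42 + t * L)\<^sup>2 \<le> M * S t" if "S t > 0" for t
  proof -
    note ug = C3_on_unit_lincomb[OF extremal_C3[of N, folded u3_def[abs_def]] g, of 1 t]
    have "ereal (\<bar>error_functional N C A B (\<lambda>x. 1 * extremal N x + t * g x)\<bar> / sqrt (S t)) \<le> ereal (sqrt M)"
      using order_trans[OF error_norm_lower[OF ug energy that, of N C A B] le] by (simp add: M_def)
    then have "\<bar>- 1 / 42 + t * L\<bar> / sqrt (S t) \<le> sqrt M"
      unfolding error_functional_lincomb[OF extremal_C3 g] error_functional_extremal[OF N] L_def by simp
    then have "\<bar>- 1 / 42 + t * L\<bar> \<le> sqrt M * sqrt (S t)"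
      using that by (simp add: field_simps)
    then have "\<bar>- 1 / 42 + t * L\<bar>\<^sup>2 \<le> (sqrt M * sqrt (S t))\<^sup>2"
      by (rule power_mono) simp
    then show ?thesis using M that by (simp add: power_mult_distrib)
  qed
  define r where "r t = M * S t - (- 1 / 42 + t * L)\<^sup>2" for t
  have r0: "r 0 = 0" using n by (simp add: r_def S_def)
  have "(S \<longlongrightarrow> n) (at 0)"
    unfolding S_def by (auto intro!: tendsto_eq_intros)
  then have "eventually (\<lambda>t. S t > 0) (at 0)"
    using n(1) by (rule order_tendstoD(1))
  then obtain d where d: "d > 0" "\<And>t. t \<noteq> 0 \<Longrightarrow> \<bar>t\<bar> < d \<Longrightarrow> S t > 0"
    unfolding eventually_at by (auto simp: dist_real_def)
  have "(r has_real_derivative (M * (2 * s) + L / 21)) (at 0)"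
    unfolding r_def[abs_def] S_def
    by (auto intro!: derivative_eq_intros simp: field_simps)
  then have "M * (2 * s) + L / 21 = 0"
  proof (rule DERIV_local_min[OF _ d(1)])
    show "\<forall>t. \<bar>0 - t\<bar> < d \<longrightarrow> r 0 \<le> r t"
    proof (intro allI impI)
      fix t assume "\<bar>0 - t\<bar> < d"
      then show "r 0 \<le> r t"
        using bound[of t] d(2)[of t] r0 by (cases "t = 0") (auto simp: r_def)
    qed
  qed
  then show ?thesis by (simp add: L_def M_def s_def u3_def)
qed

text \<open>
  A polynomial with zeros at all nodes, double at one of the two end points and simple at the other, sees
  only the derivative at the simple one. Once \<open>a\<close> and \<open>b\<close> are known to vanish, a
  Lagrange polynomial isolates each \<open>d \<beta>\<close>.
\<close>

lemma poly_functional_coeffs_zero: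
  fixes d :: "nat \<Rightarrow> real"
  assumes N: "N \<ge> 1"
    and zero: "\<And>p. (\<Sum>\<beta>=0..N. d \<beta> * poly p (1 / real N * real \<beta>))
      + a * poly (pderiv p) 0 + b * poly (pderiv p) 1 = 0"
  shows "(\<forall>\<beta>\<in>{0..N}. d \<beta> = 0) \<and> a = 0 \<and> b = 0"
proof -
  define Z where "Z S = (\<Prod>\<gamma>\<in>S. [:- (1 / real N * real \<gamma>), 1:])" for S
  have Z: "poly (Z S) (1 / real N * real \<beta>) = 0 \<longleftrightarrow> \<beta> \<in> S" if "finite S" for S \<beta>
    using N that by (auto simp: Z_def poly_prod prod_zero_iff)
  have Z01: "poly (Z S) 0 \<noteq> 0" "poly (Z S) 1 \<noteq> 0" if "S \<subseteq> {1..<N}" for S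
    using Z[of S 0] Z[of S N] that N finite_subset[OF that] by auto
  define X :: "real poly" where "X = [:0, 1:]"
  define Y :: "real poly" where "Y = [:-1, 1:]"
  have pd: "pderiv X = 1" "pderiv Y = 1" by (simp_all add: X_def Y_def pderiv_pCons)
  have XY: "poly X x = x" "poly Y x = x - 1" for x by (simp_all add: X_def Y_def)
  have sum1: "(\<Sum>\<beta>=0..N. d \<beta> * poly p (1 / real N * real \<beta>)) = d \<beta> * poly p (1 / real N * real \<beta>)"
    if "\<beta> \<le> N" "\<And>\<gamma>. \<gamma> \<le> N \<Longrightarrow> \<gamma> \<noteq> \<beta> \<Longrightarrow> poly p (1 / real N * real \<gamma>) = 0" for p \<beta>
    using that by (subst sum.remove[of _ \<beta>]) (auto intro!: sum.neutral)
  have node: "1 / real N * real \<gamma> = 1 \<longleftrightarrow> \<gamma> = N" "1 / real N * real \<gamma> = 0 \<longleftrightarrow> \<gamma> = 0" for \<gamma>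
    using N by auto
  have inner: "poly (Z {1..<N}) (1 / real N * real \<gamma>) = 0 \<longleftrightarrow> \<gamma> \<noteq> 0 \<and> \<gamma> \<noteq> N" if "\<gamma> \<le> N" for \<gamma>
    using Z[of "{1..<N}" \<gamma>] that by auto
  have a: "a = 0"
  proof -
    let ?p = "X * (Y * (Y * Z {1..<N}))"
    have "poly ?p (1 / real N * real \<gamma>) = 0" if "\<gamma> \<le> N" for \<gamma>
      using inner[OF that] node[of \<gamma>] by (auto simp only: poly_mult XY) auto
    then have "(\<Sum>\<beta>=0..N. d \<beta> * poly ?p (1 / real N * real \<beta>)) = 0" by (intro sum.neutral) auto
    with zero[of ?p] Z01(1)[of "{1..<N}"] show ?thesis by (simp add: pderiv_mult pd XY)
  qed
  have b: "b = 0"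
  proof -
    let ?p = "X * (X * (Y * Z {1..<N}))"
    have "poly ?p (1 / real N * real \<gamma>) = 0" if "\<gamma> \<le> N" for \<gamma>
      using inner[OF that] node[of \<gamma>] by (auto simp only: poly_mult XY) auto
    then have "(\<Sum>\<beta>=0..N. d \<beta> * poly ?p (1 / real N * real \<beta>)) = 0" by (intro sum.neutral) auto
    with zero[of ?p] Z01(2)[of "{1..<N}"] show ?thesis by (simp add: pderiv_mult pd XY)
  qed
  have "d \<beta> = 0" if \<beta>: "\<beta> \<le> N" for \<beta>
  proof -
    let ?p = "Z ({0..N} - {\<beta>})"
    have "(\<Sum>\<gamma>=0..N. d \<gamma> * poly ?p (1 / real N * real \<gamma>)) = d \<beta> * poly ?p (1 / real N * real \<beta>)"
      using Z[of "{0..N} - {\<beta>}"] by (intro sum1[OF \<beta>]) auto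
    moreover have "poly ?p (1 / real N * real \<beta>) \<noteq> 0" using Z[of "{0..N} - {\<beta>}" \<beta>] by simp
    ultimately show ?thesis using zero[of ?p] a b by simp
  qed
  with a b show ?thesis by simp
qed

lemma optimal_coeffs_unique:
  fixes h :: real
  assumes N: "N \<ge> 1" and h: "h = 1 / real N"
    and le: "error_norm N C A B \<le> ereal (sqrt (h^6 / 30240))"
    and le': "error_norm N C' A' B' \<le> ereal (sqrt (h^6 / 30240))"
  shows "(\<forall>\<beta>\<in>{0..N}. C \<beta> = C' \<beta>) \<and> A = A' \<and> B = B'"
proof -
  have "(\<Sum>\<beta>=0..N. (C \<beta> - C' \<beta>) * poly p (1 / real N * real \<beta>))
      + (A - A') * poly (pderiv p) 0 + (B - B') * poly (pderiv p) 1 = 0" for p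
  proof -
    have "error_functional N C A B (poly p) = error_functional N C' A' B' (poly p)"
      using error_functional_determined[OF N h le C3_on_unit_poly[of p]]
        error_functional_determined[OF N h le' C3_on_unit_poly[of p]] by simp
    moreover have "D01 (poly p) 0 = poly (pderiv p) 0" "D01 (poly p) 1 = poly (pderiv p) 1"
      using C3_on_unit_D01[OF C3_on_unit_poly[of p]] by auto
    ultimately show ?thesis
      by (simp add: error_functional_def left_diff_distrib sum_subtractf)
  qed
  from poly_functional_coeffs_zero[OF N this] show ?thesis by auto
qed

theorem corollary5p2:
  fixes N :: nat and h :: real
  assumes "N \<ge> 1" and "h = 1 / real N"
  shows "(\<exists>!q. case q of (C, A, B) \<Rightarrow> C \<in> extensional {0..N} \<and> optimal_quadrature N C A B) \<and>
    (\<forall>C A B. optimal_quadrature N C A B \<longrightarrow>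
       (\<forall>\<beta>\<in>{0..N}. C \<beta> = (if \<beta> = 0 \<or> \<beta> = N then h / 2 else h)) \<and>
       A = h\<^sup>2 / 12 \<and> B = - (h\<^sup>2 / 12) \<and>
       (error_norm N C A B)\<^sup>2 = ereal (h ^ 6 / 30240))"
proof -
  define m where "m = sqrt (h ^ 6 / 30240)"
  define C0 where "C0 = restrict (\<lambda>\<beta>. if \<beta> = 0 \<or> \<beta> = N then h / 2 else h) {0..N}"
  have lower: "ereal m \<le> error_norm N C A B" for C A B
    unfolding m_def by (rule error_norm_ge[OF assms])
  have upper: "error_norm N C0 (h\<^sup>2 / 12) (- (h\<^sup>2 / 12)) \<le> ereal m"
    unfolding m_def by (rule corrected_trapezoid_error_norm_le[OF assms]) (simp add: C0_def)
  have "(INF (C', A', B')\<in>UNIV. error_norm N C' A' B') = ereal m"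
  proof (rule antisym)
    show "(INF (C', A', B')\<in>UNIV. error_norm N C' A' B') \<le> ereal m"
      by (rule INF_lower2[of "(C0, h\<^sup>2 / 12, - (h\<^sup>2 / 12))"]) (use upper in auto)
    show "ereal m \<le> (INF (C', A', B')\<in>UNIV. error_norm N C' A' B')"
      by (rule INF_greatest) (use lower in auto)
  qed
  then have opt: "optimal_quadrature N C A B \<longleftrightarrow> error_norm N C A B = ereal m" for C A B
    by (simp add: optimal_quadrature_def)
  have opt0: "optimal_quadrature N C0 (h\<^sup>2 / 12) (- (h\<^sup>2 / 12))"
    unfolding opt using upper lower by (rule antisym)
  have unique: "(\<forall>\<beta>\<in>{0..N}. C \<beta> = C0 \<beta>) \<and> A = h\<^sup>2 / 12 \<and> B = - (h\<^sup>2 / 12)"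
    if "optimal_quadrature N C A B" for C A B
    using optimal_coeffs_unique[OF assms, of C A B C0] that upper unfolding opt m_def by simp
  have "\<exists>!q. case q of (C, A, B) \<Rightarrow> C \<in> extensional {0..N} \<and> optimal_quadrature N C A B"
  proof (rule ex1I[of _ "(C0, h\<^sup>2 / 12, - (h\<^sup>2 / 12))"])
    show "case (C0, h\<^sup>2 / 12, - (h\<^sup>2 / 12)) of (C, A, B) \<Rightarrow> C \<in> extensional {0..N} \<and> optimal_quadrature N C A B"
      using opt0 by (simp add: C0_def)
    show "q = (C0, h\<^sup>2 / 12, - (h\<^sup>2 / 12))"
      if "case q of (C, A, B) \<Rightarrow> C \<in> extensional {0..N} \<and> optimal_quadrature N C A B" for q
    proof -
      obtain C A B where q: "q = (C, A, B)" by (cases q)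
      have "C = C0"
        by (rule extensionalityI[of _ "{0..N}"]) (use that unique[of C A B] in \<open>auto simp: q C0_def\<close>)
      then show ?thesis using that unique[of C A B] by (simp add: q)
    qed
  qed
  moreover have "(ereal m)\<^sup>2 = ereal (h ^ 6 / 30240)"
    by (simp add: m_def)
  ultimately show ?thesis
    using unique opt by (auto simp: C0_def)
qed

end
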